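(* Let $\mathcal{U}$ be a coinfinite subset of $\mathcal{V}$ and let $(S,T)$ be a finitely consistent pair of subsets of $\Phi(\mathcal{U})$. Then there exist a coinfinite subset $\mathcal{U}'$ of $\mathcal{V}$ and a $\mathcal{U}'$-saturated pair $(S',T')$ such that $\mathcal{U}\subseteq\mathcal{U}'$, $S\subseteq S'$ and $T\subseteq T'$.
   Context: Formulas are those of first-order modal logic over a countable set $\mathcal{V}$ of variables, with $\top,\bot$, predicate symbols of each finite arity (no function/constant symbols), $\land,\neg,\supset$, $\forall$, and $\Box$; $\Diamond=\neg\Box\neg$. For a formula $\phi$, $\mathsf{Var}(\phi)$ is the set of variables with a free or bound occurrence in $\phi$, and for $\mathcal{U}\subseteq\mathcal{V}$, $\Phi(\mathcal{U})$ is the set of formulas $\phi$ with $\mathsf{Var}(\phi)\subseteq\mathcal{U}$. $\mathsf{NQGL}^-$ is the following sequent calculus (sequents $\Gamma\rightarrow\Delta$ are pairs of finite sets of formulas). Axioms: $p\rightarrow p$ ($p$ atomic), $\rightarrow\top$, $\bot\rightarrow$. Rules: weakening (from $\Gamma\rightarrow\Delta$ infer $\Gamma'\rightarrow\Delta'$ for $\Gamma\subseteq\Gamma'$, $\Delta\subseteq\Delta'$); standard LK rules for $\land$ (right: from $\Gamma\rightarrow\Delta,\phi$ and $\Gamma\rightarrow\Delta,\psi$ infer $\Gamma\rightarrow\Delta,\phi\land\psi$; left: from $\phi,\Gamma\rightarrow\Delta$ or $\psi,\Gamma\rightarrow\Delta$ infer $\phi\land\psi,\Gamma\rightarrow\Delta$),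 for $\supset$ (right: from $\phi,\Gamma\rightarrow\Delta,\psi$ infer $\Gamma\rightarrow\Delta,\phi\supset\psi$; left: from $\Gamma\rightarrow\Delta,\phi$ and $\psi,\Lambda\rightarrow\Xi$ infer $\phi\supset\psi,\Gamma,\Lambda\rightarrow\Delta,\Xi$), for $\neg$ (from $\phi,\Gamma\rightarrow\Delta$ infer $\Gamma\rightarrow\Delta,\neg\phi$; from $\Gamma\rightarrow\Delta,\phi$ infer $\neg\phi,\Gamma\rightarrow\Delta$), for $\forall$ (from $\Gamma\rightarrow\Delta,\phi[y/x]$ infer $\Gamma\rightarrow\Delta,\forall x\phi$ with $y$ not occurring in the lower sequent; from $\phi[z/x],\Gamma\rightarrow\Delta$ infer $\forall x\phi,\Gamma\rightarrow\Delta$ for any $z$); (Box) from $\Box\Gamma,\Delta\rightarrow\phi$ infer $\Box\Gamma,\Box\Delta\rightarrow\Box\phi$ (where $\Box\Gamma=\{\Box\gamma\mid\gamma\in\Gamma\}$); and (Boundedness of length) from $\Gamma\rightarrow\Delta,\Diamond^n\top$ for all $n\in\mathbb{N}$ infer $\Gamma\rightarrow\Delta$. There is no cut rule. $\vdash_{\mathsf{NQGL}^-}\Gamma\rightarrow\Delta$ means derivable (derivations may be infinitary). A pair $(S,T)$ of sets of formulas is finitely consistent if for all finite $S'\subseteq S$, $T'\subseteq T$, $\not\vdash_{\mathsf{NQGL}^-}S'\rightarrow T'$. For $\mathcal{U}\subseteq\mathcal{V}$, a finitely consistent pair $(S,T)$ of subsets of $\Phi(\mathcal{U})$ is $\mathcal{U}$-saturated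 if: (1) $\phi_1\land\phi_2\in S$ implies $\phi_1,\phi_2\in S$, and $\phi_1\land\phi_2\in T$ implies $\phi_1\in T$ or $\phi_2\in T$; (2) $\phi_1\supset\phi_2\in S$ implies $\phi_1\in T$ or $\phi_2\in S$, and $\phi_1\supset\phi_2\in T$ implies $\phi_1\in S$ and $\phi_2\in T$; (3) $\neg\phi\in S$ implies $\phi\in T$, and $\neg\phi\in T$ implies $\phi\in S$; (4) $\forall x\phi\in S$ implies $\phi[z/x]\in S$ for all $z\in\mathcal{U}$, and $\forall x\phi\in T$ implies $\phi[z/x]\in T$ for some $z\in\mathcal{U}$.
   Formalization: The language is assumed to have only countably many predicate symbols, which the setting leaves unsaid; with uncountably many predicate symbols over countably many variables the claim fails. *)

theory Defs
  imports Main "HOL-Library.Countable" "HOL-Combinatorics.Transposition"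
begin

text \<open>
  A predicate symbol of arity \<open>n\<close> is a name in \<^typ>\<open>'p\<close> used with an argument list of
  length \<open>n\<close>; the same name with lists of different lengths stands for different symbols.
  The generated set function \<open>vars\<close> collects all variables with a free or bound
  occurrence, the variable next to a quantifier included.
\<close>

datatype (dead 'p, vars: 'v) fm =
    Top
  | Bot
  | Pred 'p "'v list"
  | And "('p, 'v) fm" "('p, 'v) fm"
  | Neg "('p, 'v) fm"
  | Imp "('p, 'v) fm" "('p, 'v) fm"
  | All 'v "('p, 'v) fm"
  | Box "('p, 'v) fm"
  for map: rename

definition Dia :: "('p, 'v) fm \<Rightarrow> ('p, 'v) fm" where
  "Dia \<phi> = Neg (Box (Neg \<phi>))"

definition formulas_over :: "'v set \<Rightarrow> ('p, 'v) fm set" where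
  "formulas_over U = {\<phi>. vars \<phi> \<subseteq> U}"

primrec free_vars :: "('p, 'v) fm \<Rightarrow> 'v set" where
  "free_vars Top = {}"
| "free_vars Bot = {}"
| "free_vars (Pred p xs) = set xs"
| "free_vars (And \<phi> \<psi>) = free_vars \<phi> \<union> free_vars \<psi>"
| "free_vars (Neg \<phi>) = free_vars \<phi>"
| "free_vars (Imp \<phi> \<psi>) = free_vars \<phi> \<union> free_vars \<psi>"
| "free_vars (All x \<phi>) = free_vars \<phi> - {x}"
| "free_vars (Box \<phi>) = free_vars \<phi>"

text \<open>
  \<open>subst \<phi> z x\<close> is the capture-avoiding substitution \<open>\<phi>[z/x]\<close>. A bound variable has to be
  renamed only in \<open>\<forall>z \<psi>\<close> with \<open>x\<close> free in \<open>\<psi>\<close>. Since \<open>x\<close> is no longer free in the result,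
  it can serve as the new bound variable, so that exchanging \<open>x\<close> and \<open>z\<close> throughout \<open>\<psi>\<close>
  does both the renaming and the substitution. Hence no variable outside
  \<open>vars \<phi> \<union> {z}\<close> is introduced, and \<open>formulas_over U\<close> is closed under \<open>[z/x]\<close>
  for \<open>z \<in> U\<close>. Choosing the new bound variable from outside \<open>U\<close> would break this.
\<close>

primrec subst :: "('p, 'v) fm \<Rightarrow> 'v \<Rightarrow> 'v \<Rightarrow> ('p, 'v) fm" where
  "subst Top z x = Top"
| "subst Bot z x = Bot"
| "subst (Pred p xs) z x = Pred p (map (\<lambda>y. if y = x then z else y) xs)"
| "subst (And \<phi> \<psi>) z x = And (subst \<phi> z x) (subst \<psi> z x)"
| "subst (Neg \<phi>) z x = Neg (subst \<phi> z x)"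
| "subst (Imp \<phi> \<psi>) z x = Imp (subst \<phi> z x) (subst \<psi> z x)"
| "subst (All y \<psi>) z x =
    (if y = x then All y \<psi>
     else if y = z \<and> x \<in> free_vars \<psi> then All x (rename (transpose x z) \<psi>)
     else All y (subst \<psi> z x))"
| "subst (Box \<phi>) z x = Box (subst \<phi> z x)"

lemma free_vars_rename: "inj f \<Longrightarrow> free_vars (rename f \<phi>) = f ` free_vars \<phi>"
  by (induction \<phi>) (auto simp: image_Un image_set_diff)

lemma free_vars_subset_vars: "free_vars \<phi> \<subseteq> vars \<phi>"
  by (induction \<phi>) auto

lemma subst_not_free: "x \<notin> free_vars \<phi> \<Longrightarrow> subst \<phi> z x = \<phi>"
  by (induction \<phi>) (auto intro: map_idI)

lemma free_vars_subst:
  "free_vars (subst \<phi> z x) =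
    (if x \<in> free_vars \<phi> then insert z (free_vars \<phi> - {x}) else free_vars \<phi>)"
proof (induction \<phi>)
  case (All y \<psi>)
  have "inj (transpose x z)" by simp
  from free_vars_rename[OF this]
  have ren: "free_vars (rename (transpose x z) \<psi>) = transpose x z ` free_vars \<psi>" .
  show ?case
    using All by (auto simp: ren transpose_def image_iff subst_not_free split: if_splits)
qed (auto split: if_splits)

lemma vars_subst: "vars (subst \<phi> z x) \<subseteq> insert z (vars \<phi>)"
proof (induction \<phi>)
  case (All y \<psi>)
  have "x \<in> free_vars \<psi> \<Longrightarrow> x \<in> vars \<psi>" by (rule subsetD[OF free_vars_subset_vars])
  with All show ?case
    by (auto simp: fm.set_map transpose_def split: if_splits)
qed (auto split: if_splits)

text \<open>
  Derivability in \<open>NQGL\<^sup>-\<close>. Sequents are pairs of finite sets; finiteness needs to be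
  imposed only in the weakening rule, since all other rules preserve it. The rule
  \<open>Bounded\<close> has one premise for each natural number.
\<close>

inductive NQGL :: "('p, 'v) fm set \<Rightarrow> ('p, 'v) fm set \<Rightarrow> bool" (infix "\<turnstile>" 50) where
  Ax: "{Pred p xs} \<turnstile> {Pred p xs}"
| TopR: "{} \<turnstile> {Top}"
| BotL: "{Bot} \<turnstile> {}"
| Weak: "\<Gamma> \<turnstile> \<Delta> \<Longrightarrow> \<Gamma> \<subseteq> \<Gamma>' \<Longrightarrow> \<Delta> \<subseteq> \<Delta>' \<Longrightarrow> finite \<Gamma>' \<Longrightarrow> finite \<Delta>' \<Longrightarrow> \<Gamma>' \<turnstile> \<Delta>'"
| AndR: "\<Gamma> \<turnstile> insert \<phi> \<Delta> \<Longrightarrow> \<Gamma> \<turnstile> insert \<psi> \<Delta> \<Longrightarrow> \<Gamma> \<turnstile> insert (And \<phi> \<psi>) \<Delta>"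
| AndL1: "insert \<phi> \<Gamma> \<turnstile> \<Delta> \<Longrightarrow> insert (And \<phi> \<psi>) \<Gamma> \<turnstile> \<Delta>"
| AndL2: "insert \<psi> \<Gamma> \<turnstile> \<Delta> \<Longrightarrow> insert (And \<phi> \<psi>) \<Gamma> \<turnstile> \<Delta>"
| ImpR: "insert \<phi> \<Gamma> \<turnstile> insert \<psi> \<Delta> \<Longrightarrow> \<Gamma> \<turnstile> insert (Imp \<phi> \<psi>) \<Delta>"
| ImpL: "\<Gamma> \<turnstile> insert \<phi> \<Delta> \<Longrightarrow> insert \<psi> \<Lambda> \<turnstile> \<Xi> \<Longrightarrow> insert (Imp \<phi> \<psi>) (\<Gamma> \<union> \<Lambda>) \<turnstile> \<Delta> \<union> \<Xi>"
| NegR: "insert \<phi> \<Gamma> \<turnstile> \<Delta> \<Longrightarrow> \<Gamma> \<turnstile> insert (Neg \<phi>) \<Delta>"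
| NegL: "\<Gamma> \<turnstile> insert \<phi> \<Delta> \<Longrightarrow> insert (Neg \<phi>) \<Gamma> \<turnstile> \<Delta>"
| AllR: "\<Gamma> \<turnstile> insert (subst \<phi> y x) \<Delta> \<Longrightarrow> y \<notin> (\<Union>\<psi> \<in> \<Gamma> \<union> insert (All x \<phi>) \<Delta>. vars \<psi>)
    \<Longrightarrow> \<Gamma> \<turnstile> insert (All x \<phi>) \<Delta>"
| AllL: "insert (subst \<phi> z x) \<Gamma> \<turnstile> \<Delta> \<Longrightarrow> insert (All x \<phi>) \<Gamma> \<turnstile> \<Delta>"
| BoxR: "Box ` \<Gamma> \<union> \<Delta> \<turnstile> {\<phi>} \<Longrightarrow> Box ` \<Gamma> \<union> Box ` \<Delta> \<turnstile> {Box \<phi>}"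
| Bounded: "(\<And>n. \<Gamma> \<turnstile> insert ((Dia ^^ n) Top) \<Delta>) \<Longrightarrow> \<Gamma> \<turnstile> \<Delta>"

lemma NQGL_finite: "\<Gamma> \<turnstile> \<Delta> \<Longrightarrow> finite \<Gamma> \<and> finite \<Delta>"
  by (induction rule: NQGL.induct) auto

definition finitely_consistent :: "('p, 'v) fm set \<Rightarrow> ('p, 'v) fm set \<Rightarrow> bool" where
  "finitely_consistent S T \<longleftrightarrow>
    (\<forall>S' T'. finite S' \<and> S' \<subseteq> S \<and> finite T' \<and> T' \<subseteq> T \<longrightarrow> \<not> S' \<turnstile> T')"

definition saturated :: "'v set \<Rightarrow> ('p, 'v) fm set \<Rightarrow> ('p, 'v) fm set \<Rightarrow> bool" where
  "saturated U S T \<longleftrightarrow>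
    S \<subseteq> formulas_over U \<and> T \<subseteq> formulas_over U \<and> finitely_consistent S T \<and>
    (\<forall>\<phi> \<psi>. And \<phi> \<psi> \<in> S \<longrightarrow> \<phi> \<in> S \<and> \<psi> \<in> S) \<and>
    (\<forall>\<phi> \<psi>. And \<phi> \<psi> \<in> T \<longrightarrow> \<phi> \<in> T \<or> \<psi> \<in> T) \<and>
    (\<forall>\<phi> \<psi>. Imp \<phi> \<psi> \<in> S \<longrightarrow> \<phi> \<in> T \<or> \<psi> \<in> S) \<and>
    (\<forall>\<phi> \<psi>. Imp \<phi> \<psi> \<in> T \<longrightarrow> \<phi> \<in> S \<and> \<psi> \<in> T) \<and>
    (\<forall>\<phi>. Neg \<phi> \<in> S \<longrightarrow> \<phi> \<in> T) \<and>
    (\<forall>\<phi>. Neg \<phi> \<in> T \<longrightarrow> \<phi> \<in> S) \<and>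
    (\<forall>x \<phi>. All x \<phi> \<in> S \<longrightarrow> (\<forall>z \<in> U. subst \<phi> z x \<in> S)) \<and>
    (\<forall>x \<phi>. All x \<phi> \<in> T \<longrightarrow> (\<exists>z \<in> U. subst \<phi> z x \<in> T))"

end

(*
  A Lindenbaum construction that does without cut: the formulas over an enlarged, still coinfinite
  set of variables are enumerated, and each is put on the left, and then on the right, whenever this
  preserves finite consistency. A universal formula put on the right is accompanied by an instance
  at a fresh variable. The resulting pair is maximal among the finitely consistent pairs, and the
  remaining saturation conditions follow from maximality: if the principal formula of a logical rule
  belongs to a finitely consistent pair, then adding the side formulas of some premise of that rule
  keeps the pair finitely consistent.
*)
theory Submission
  imports Defs "HOL-Library.Infinite_Set"
begin

instance fm :: (countable, countable) countable
  by countable_datatype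

lemma finite_vars: "finite (vars \<phi>)"
  by (induction \<phi>) auto

text \<open>Each element of \<open>F\<close> appears at some stage, and monotonicity allows passing
  to the maximum of finitely many stages. This is what carries finite consistency over to a
  limit.\<close>

lemma finite_subset_incseq:
  assumes "finite F" "F \<subseteq> (\<Union>n. A n)" "mono (A :: nat \<Rightarrow> 'a set)"
  shows "\<exists>n. F \<subseteq> A n"
  using assms(1,2)
proof (induction F)
  case (insert x F)
  then obtain m n where "F \<subseteq> A n" "x \<in> A m" by auto
  then have "insert x F \<subseteq> A (max m n)"
    using monoD[OF assms(3), of m "max m n"] monoD[OF assms(3), of n "max m n"] by auto
  then show ?case ..
qed simp

section \<open>Finite consistency and derivations witnessing its failure\<close>

lemma finitely_consistent_mono:
  "finitely_consistent S T \<Longrightarrow> S' \<subseteq> S \<Longrightarrow> T' \<subseteq> T \<Longrightarrow> finitely_consistent S' T'"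
  unfolding finitely_consistent_def by (meson order_trans)

lemma finitely_consistentD:
  "finitely_consistent S T \<Longrightarrow> \<Gamma> \<turnstile> \<Delta> \<Longrightarrow> \<Gamma> \<subseteq> S \<Longrightarrow> \<Delta> \<subseteq> T \<Longrightarrow> False"
  unfolding finitely_consistent_def by (meson NQGL_finite)

text \<open>A derivation witnessing the inconsistency may use only some formulas of \<open>F\<close>
  and \<open>G\<close>. Weakening supplies the others, so that the sequent has the shape of a
  premise with side formulas \<open>F\<close> and \<open>G\<close> and a context from
  \<open>S\<close> and \<open>T\<close>.\<close>

lemma inconsistent_insertE:
  assumes "\<not> finitely_consistent (F \<union> S) (G \<union> T)" "finite F" "finite G"
  obtains \<Gamma> \<Delta> where "F \<union> \<Gamma> \<turnstile> G \<union> \<Delta>" "\<Gamma> \<subseteq> S" "\<Delta> \<subseteq> T" "finite \<Gamma>" "finite \<Delta>"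
proof -
  obtain S' T' where d: "S' \<turnstile> T'" "S' \<subseteq> F \<union> S" "T' \<subseteq> G \<union> T" and fin: "finite S'" "finite T'"
    using assms(1) unfolding finitely_consistent_def by blast
  have "F \<union> (S' - F) \<turnstile> G \<union> (T' - G)"
    using d(1) by (rule Weak) (use fin assms(2,3) in auto)
  then show thesis
    by (rule that) (use d fin in auto)
qed

lemmas inconsistent_insertLE =
  inconsistent_insertE[where F = "{\<phi>}" and G = "{}" for \<phi>, simplified]
lemmas inconsistent_insertRE =
  inconsistent_insertE[where F = "{}" and G = "{\<phi>}" for \<phi>, simplified]
lemmas inconsistent_insertLRE =
  inconsistent_insertE[where F = "{\<phi>}" and G = "{\<psi>}" for \<phi> \<psi>, simplified]

section \<open>Side formulas of the logical rules\<close>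

context
  fixes S T :: "('p, 'v) fm set"
  assumes cons: "finitely_consistent S T"
begin

text \<open>Contrapositive of the rule: a derivable premise with context from \<open>S\<close> and
  \<open>T\<close> makes the conclusion derivable, and the principal formula of the conclusion
  already lies in \<open>S\<close>. The lemmas for the other rules follow the same pattern.\<close>

lemma consistent_AndL1:
  assumes "And \<phi> \<psi> \<in> S"
  shows "finitely_consistent (insert \<phi> S) T"
proof (rule ccontr)
  assume "\<not> ?thesis"
  then obtain \<Gamma> \<Delta> where d: "insert \<phi> \<Gamma> \<turnstile> \<Delta>" and sub: "\<Gamma> \<subseteq> S" "\<Delta> \<subseteq> T"
    by (rule inconsistent_insertLE)
  from cons AndL1[OF d] show False
    by (rule finitely_consistentD) (use assms sub in auto)
qed

lemma consistent_AndL2: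
  assumes "And \<phi> \<psi> \<in> S"
  shows "finitely_consistent (insert \<psi> S) T"
proof (rule ccontr)
  assume "\<not> ?thesis"
  then obtain \<Gamma> \<Delta> where d: "insert \<psi> \<Gamma> \<turnstile> \<Delta>" and sub: "\<Gamma> \<subseteq> S" "\<Delta> \<subseteq> T"
    by (rule inconsistent_insertLE)
  from cons AndL2[OF d] show False
    by (rule finitely_consistentD) (use assms sub in auto)
qed

lemma consistent_AndR:
  assumes "And \<phi> \<psi> \<in> T"
  shows "finitely_consistent S (insert \<phi> T) \<or> finitely_consistent S (insert \<psi> T)"
proof (rule ccontr)
  assume neg: "\<not> ?thesis"
  then have "\<not> finitely_consistent S (insert \<phi> T)" by simp
  then obtain \<Gamma> \<Delta> where d1: "\<Gamma> \<turnstile> insert \<phi> \<Delta>"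
    and sub1: "\<Gamma> \<subseteq> S" "\<Delta> \<subseteq> T" and fin1: "finite \<Gamma>" "finite \<Delta>"
    by (rule inconsistent_insertRE)
  from neg have "\<not> finitely_consistent S (insert \<psi> T)" by simp
  then obtain \<Gamma>' \<Delta>' where d2: "\<Gamma>' \<turnstile> insert \<psi> \<Delta>'"
    and sub2: "\<Gamma>' \<subseteq> S" "\<Delta>' \<subseteq> T" and fin2: "finite \<Gamma>'" "finite \<Delta>'"
    by (rule inconsistent_insertRE)
  \<comment> \<open>\<open>AndR\<close> wants the same context in both premises, but the two
    derivations come with unrelated contexts; hence the unions.\<close>
  have "\<Gamma> \<union> \<Gamma>' \<turnstile> insert \<phi> (\<Delta> \<union> \<Delta>')"
    by (rule Weak[OF d1]) (use fin1 fin2 in auto)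
  moreover have "\<Gamma> \<union> \<Gamma>' \<turnstile> insert \<psi> (\<Delta> \<union> \<Delta>')"
    by (rule Weak[OF d2]) (use fin1 fin2 in auto)
  ultimately have "\<Gamma> \<union> \<Gamma>' \<turnstile> insert (And \<phi> \<psi>) (\<Delta> \<union> \<Delta>')"
    by (rule AndR)
  with cons show False
    by (rule finitely_consistentD) (use assms sub1 sub2 in auto)
qed

lemma consistent_ImpL:
  assumes "Imp \<phi> \<psi> \<in> S"
  shows "finitely_consistent S (insert \<phi> T) \<or> finitely_consistent (insert \<psi> S) T"
proof (rule ccontr)
  assume neg: "\<not> ?thesis"
  then have "\<not> finitely_consistent S (insert \<phi> T)" by simp
  then obtain \<Gamma> \<Delta> where d1: "\<Gamma> \<turnstile> insert \<phi> \<Delta>" and sub1: "\<Gamma> \<subseteq> S" "\<Delta> \<subseteq> T"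
    by (rule inconsistent_insertRE)
  from neg have "\<not> finitely_consistent (insert \<psi> S) T" by simp
  then obtain \<Gamma>' \<Delta>' where d2: "insert \<psi> \<Gamma>' \<turnstile> \<Delta>'" and sub2: "\<Gamma>' \<subseteq> S" "\<Delta>' \<subseteq> T"
    by (rule inconsistent_insertLE)
  from cons ImpL[OF d1 d2] show False
    by (rule finitely_consistentD) (use assms sub1 sub2 in auto)
qed

lemma consistent_ImpR:
  assumes "Imp \<phi> \<psi> \<in> T"
  shows "finitely_consistent (insert \<phi> S) (insert \<psi> T)"
proof (rule ccontr)
  assume "\<not> ?thesis"
  then obtain \<Gamma> \<Delta> where d: "insert \<phi> \<Gamma> \<turnstile> insert \<psi> \<Delta>" and sub: "\<Gamma> \<subseteq> S" "\<Delta> \<subseteq> T"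
    by (rule inconsistent_insertLRE)
  from cons ImpR[OF d] show False
    by (rule finitely_consistentD) (use assms sub in auto)
qed

lemma consistent_NegL:
  assumes "Neg \<phi> \<in> S"
  shows "finitely_consistent S (insert \<phi> T)"
proof (rule ccontr)
  assume "\<not> ?thesis"
  then obtain \<Gamma> \<Delta> where d: "\<Gamma> \<turnstile> insert \<phi> \<Delta>" and sub: "\<Gamma> \<subseteq> S" "\<Delta> \<subseteq> T"
    by (rule inconsistent_insertRE)
  from cons NegL[OF d] show False
    by (rule finitely_consistentD) (use assms sub in auto)
qed

lemma consistent_NegR:
  assumes "Neg \<phi> \<in> T"
  shows "finitely_consistent (insert \<phi> S) T"
proof (rule ccontr)
  assume "\<not> ?thesis"
  then obtain \<Gamma> \<Delta> where d: "insert \<phi> \<Gamma> \<turnstile> \<Delta>" and sub: "\<Gamma> \<subseteq> S" "\<Delta> \<subseteq> T"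
    by (rule inconsistent_insertLE)
  from cons NegR[OF d] show False
    by (rule finitely_consistentD) (use assms sub in auto)
qed

lemma consistent_AllL:
  assumes "All x \<phi> \<in> S"
  shows "finitely_consistent (insert (subst \<phi> z x) S) T"
proof (rule ccontr)
  assume "\<not> ?thesis"
  then obtain \<Gamma> \<Delta> where d: "insert (subst \<phi> z x) \<Gamma> \<turnstile> \<Delta>" and sub: "\<Gamma> \<subseteq> S" "\<Delta> \<subseteq> T"
    by (rule inconsistent_insertLE)
  from cons AllL[OF d] show False
    by (rule finitely_consistentD) (use assms sub in auto)
qed

lemma consistent_AllR:
  assumes "All x \<phi> \<in> T" "y \<notin> (\<Union>\<psi> \<in> S \<union> T. vars \<psi>)"
  shows "finitely_consistent S (insert (subst \<phi> y x) T)"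
proof (rule ccontr)
  assume "\<not> ?thesis"
  then obtain \<Gamma> \<Delta> where d: "\<Gamma> \<turnstile> insert (subst \<phi> y x) \<Delta>" and sub: "\<Gamma> \<subseteq> S" "\<Delta> \<subseteq> T"
    by (rule inconsistent_insertRE)
  \<comment> \<open>The eigenvariable condition holds because \<open>y\<close> is fresh for all of
    \<open>S\<close> and \<open>T\<close>, which contain the context and the principal
    formula.\<close>
  have "\<Gamma> \<turnstile> insert (All x \<phi>) \<Delta>"
    using d by (rule AllR) (use assms sub in blast)
  with cons show False
    by (rule finitely_consistentD) (use assms sub in auto)
qed

end

section \<open>Saturation from maximality\<close>

text \<open>Witnesses for universal formulas in \<open>T\<close> are a separate assumption: every
  variable of \<open>U\<close> may occur in a maximal pair, and then \<open>consistent_AllR\<close>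
  offers no instance over \<open>U\<close>.\<close>

lemma saturated_if_maximal:
  assumes over: "S \<subseteq> formulas_over U" "T \<subseteq> formulas_over U"
    and cons: "finitely_consistent S T"
    and maxL: "\<And>\<phi>. \<phi> \<in> formulas_over U \<Longrightarrow> finitely_consistent (insert \<phi> S) T \<Longrightarrow> \<phi> \<in> S"
    and maxR: "\<And>\<phi>. \<phi> \<in> formulas_over U \<Longrightarrow> finitely_consistent S (insert \<phi> T) \<Longrightarrow> \<phi> \<in> T"
    and wit: "\<And>x \<phi>. All x \<phi> \<in> T \<Longrightarrow> \<exists>z \<in> U. subst \<phi> z x \<in> T"
  shows "saturated U S T"
proof -
  have over': "vars \<phi> \<subseteq> U" if "\<phi> \<in> S \<union> T" for \<phi>
    using that over by (auto simp: formulas_over_def)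
  have L: "\<phi> \<in> S" if "finitely_consistent (insert \<phi> S) T" "vars \<phi> \<subseteq> U" for \<phi>
    using that maxL by (auto simp: formulas_over_def)
  have R: "\<phi> \<in> T" if "finitely_consistent S (insert \<phi> T)" "vars \<phi> \<subseteq> U" for \<phi>
    using that maxR by (auto simp: formulas_over_def)
  have "\<phi> \<in> S \<and> \<psi> \<in> S" if "And \<phi> \<psi> \<in> S" for \<phi> \<psi>
    using consistent_AndL1[OF cons that] consistent_AndL2[OF cons that]
      over'[of "And \<phi> \<psi>"] that
    by (auto intro: L)
  moreover have "\<phi> \<in> T \<or> \<psi> \<in> T" if "And \<phi> \<psi> \<in> T" for \<phi> \<psi>
    using consistent_AndR[OF cons that] over'[of "And \<phi> \<psi>"] that by (auto intro: R)
  moreover have "\<phi> \<in> T \<or> \<psi> \<in> S" if "Imp \<phi> \<psi> \<in> S" for \<phi> \<psi>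
    using consistent_ImpL[OF cons that] over'[of "Imp \<phi> \<psi>"] that by (auto intro: L R)
  \<comment> \<open>The two side formulas can be added jointly; monotonicity lets each be added
    alone, as maximality requires.\<close>
  moreover have "\<phi> \<in> S \<and> \<psi> \<in> T" if "Imp \<phi> \<psi> \<in> T" for \<phi> \<psi>
    using consistent_ImpR[OF cons that] over'[of "Imp \<phi> \<psi>"] that
    by (auto intro: L R elim: finitely_consistent_mono)
  moreover have "\<phi> \<in> T" if "Neg \<phi> \<in> S" for \<phi>
    using consistent_NegL[OF cons that] over'[of "Neg \<phi>"] that by (auto intro: R)
  moreover have "\<phi> \<in> S" if "Neg \<phi> \<in> T" for \<phi>
    using consistent_NegR[OF cons that] over'[of "Neg \<phi>"] that by (auto intro: L)
  \<comment> \<open>The substitution brings in no variable besides \<open>z\<close>, so the instance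
    stays over \<open>U\<close>.\<close>
  moreover have "subst \<phi> z x \<in> S" if "All x \<phi> \<in> S" "z \<in> U" for x \<phi> z
    using consistent_AllL[OF cons that(1)] over'[of "All x \<phi>"] that vars_subst[of \<phi> z x]
    by (intro L) auto
  ultimately show ?thesis
    unfolding saturated_def using over cons wit by blast
qed

section \<open>Deciding a single formula\<close>

text \<open>
  The finiteness condition keeps fresh variables available throughout the construction even when
  \<open>S\<close> and \<open>T\<close> are infinite.
\<close>

definition extension_stage ::
    "'v set \<Rightarrow> 'v set \<Rightarrow> ('p, 'v) fm set \<times> ('p, 'v) fm set \<Rightarrow> bool" where
  "extension_stage U U' = (\<lambda>(S, T).
    S \<subseteq> formulas_over U' \<and> T \<subseteq> formulas_over U' \<and> finitely_consistent S T \<and>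
    finite ((\<Union>\<psi> \<in> S \<union> T. vars \<psi>) - U))"

text \<open>The premises speak of the current pair. A formula consistent with a later, larger pair
  is also consistent with this one, so the decision remains valid in the limit.\<close>

definition decides ::
    "'v set \<Rightarrow> ('p, 'v) fm \<Rightarrow> ('p, 'v) fm set \<times> ('p, 'v) fm set \<Rightarrow> bool" where
  "decides U \<chi> = (\<lambda>(S, T).
    (finitely_consistent (insert \<chi> S) T \<longrightarrow> \<chi> \<in> S) \<and>
    (finitely_consistent S (insert \<chi> T) \<longrightarrow>
      \<chi> \<in> T \<and> (\<forall>x \<phi>. \<chi> = All x \<phi> \<longrightarrow> (\<exists>z \<in> U. subst \<phi> z x \<in> T))))"

lemma extension_stage_insertL:
  assumes "extension_stage U U' (S, T)" "\<chi> \<in> formulas_over U'"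
    and "finitely_consistent (insert \<chi> S) T"
  shows "extension_stage U U' (insert \<chi> S, T)"
  using assms by (auto simp: extension_stage_def Un_Diff finite_vars)

lemma extension_stage_insertR:
  assumes "extension_stage U U' (S, T)" "\<chi> \<in> formulas_over U'"
    and "finitely_consistent S (insert \<chi> T)"
  shows "extension_stage U U' (S, insert \<chi> T)"
  using assms by (auto simp: extension_stage_def Un_Diff finite_vars)

lemma extension_stage_decide:
  assumes inf: "infinite (U' - U)"
    and stage: "extension_stage U U' (S, T)" and \<chi>: "\<chi> \<in> formulas_over U'"
  shows "\<exists>S' T'. extension_stage U U' (S', T') \<and> S \<subseteq> S' \<and> T \<subseteq> T' \<and> decides U' \<chi> (S', T')"
proof -
  define S' where "S' = (if finitely_consistent (insert \<chi> S) T then insert \<chi> S else S)"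
  have S': "S \<subseteq> S'" "extension_stage U U' (S', T)"
    using stage \<chi> by (auto simp: S'_def intro: extension_stage_insertL)
  \<comment> \<open>Consistency of the larger pair would already have put \<open>\<chi>\<close> into
    \<open>S'\<close>; additions on the right thus leave the decision on the left intact.\<close>
  have decL: "\<chi> \<in> S'" if "finitely_consistent (insert \<chi> S') T'" "T \<subseteq> T'" for T'
    using finitely_consistent_mono[OF that(1), of "insert \<chi> S" T] S'(1) that(2)
    by (auto simp: S'_def)
  show ?thesis
  proof (cases "finitely_consistent S' (insert \<chi> T)")
    case False
    then show ?thesis
      using S' decL by (intro exI[of _ S'] exI[of _ T]) (auto simp: decides_def)
  next
    case True
    have stage': "extension_stage U U' (S', insert \<chi> T)"
      using S'(2) \<chi> True by (rule extension_stage_insertR)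
    show ?thesis
    proof (cases "\<exists>x \<phi>. \<chi> = All x \<phi>")
      case False
      then show ?thesis
        using S' stage' decL
        by (intro exI[of _ S'] exI[of _ "insert \<chi> T"]) (auto simp: decides_def)
    next
      case ex: True
      then obtain x \<phi> where [simp]: "\<chi> = All x \<phi>" by blast
      have "finite ((\<Union>\<psi> \<in> S' \<union> insert \<chi> T. vars \<psi>) - U)"
        using stage' by (simp only: extension_stage_def split_conv)
      \<comment> \<open>Only finitely many variables outside \<open>U\<close> are in use at a stage,
        so infinitely many of \<open>U' - U\<close> remain for the witness \<open>y\<close>.\<close>
      then have "infinite (U' - U - ((\<Union>\<psi> \<in> S' \<union> insert \<chi> T. vars \<psi>) - U))"
        using inf by (rule Diff_infinite_finite)
      then obtain y where y: "y \<in> U'" "y \<notin> (\<Union>\<psi> \<in> S' \<union> insert \<chi> T. vars \<psi>)"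
        by (metis (no_types, lifting) Diff_iff ex_in_conv finite.emptyI)
      \<comment> \<open>\<open>consistent_AllR\<close> is applied to the pair that already contains
        \<open>\<chi>\<close> on the right, since it requires the universal formula to be a
        member.\<close>
      have "finitely_consistent S' (insert (subst \<phi> y x) (insert \<chi> T))"
        using True _ y(2) by (rule consistent_AllR) simp
      moreover have "subst \<phi> y x \<in> formulas_over U'"
        using \<chi> y(1) vars_subst[of \<phi> y x] by (auto simp: formulas_over_def)
      ultimately have "extension_stage U U' (S', insert (subst \<phi> y x) (insert \<chi> T))"
        using stage' by (simp add: extension_stage_insertR)
      then show ?thesis
        using S'(1) y(1) decL
        by (intro exI[of _ S'] exI[of _ "insert (subst \<phi> y x) (insert \<chi> T)"])
          (auto simp: decides_def)
    qed
  qed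
qed

section \<open>Iteration through all formulas and passage to the limit\<close>

theorem theorem6:
  fixes U :: "'v::countable set" and S T :: "('p::countable, 'v) fm set"
  assumes "infinite (- U)"
    and "S \<subseteq> formulas_over U" and "T \<subseteq> formulas_over U"
    and "finitely_consistent S T"
  shows "\<exists>U' S' T'. infinite (- U') \<and> saturated U' S' T' \<and> U \<subseteq> U' \<and> S \<subseteq> S' \<and> T \<subseteq> T'"
proof -
  \<comment> \<open>\<open>W\<close> provides the fresh variables for witnesses, while
    \<open>C\<close> is kept outside \<open>U'\<close> to make it coinfinite.\<close>
  obtain W C where W: "W \<subseteq> - U" "C \<subseteq> - U" "infinite W" "infinite C" "W \<inter> C = {}"
    using assms(1) by (rule infinite_split)
  define U' where "U' = U \<union> W"
  have "W = U' - U"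
    using W(1) by (auto simp: U'_def)
  with W(3) have inf: "infinite (U' - U)" by simp
  have "C \<subseteq> - U'"
    using W(2,5) by (auto simp: U'_def)
  with W(4) have coinf: "infinite (- U')"
    using finite_subset by blast

  define P :: "('p, 'v) fm set \<times> ('p, 'v) fm set \<Rightarrow> bool"
    where "P = extension_stage U U'"
  define le :: "('p, 'v) fm set \<times> ('p, 'v) fm set \<Rightarrow> _ \<Rightarrow> bool"
    where "le p q \<longleftrightarrow> fst p \<subseteq> fst q \<and> snd p \<subseteq> snd q" for p q
  have start: "P (S, T)"
  proof -
    have "S \<subseteq> formulas_over U'" "T \<subseteq> formulas_over U'"
      using assms(2,3) by (auto simp: formulas_over_def U'_def)
    moreover have "(\<Union>\<psi> \<in> S \<union> T. vars \<psi>) - U = {}"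
      using assms(2,3) by (auto simp: formulas_over_def)
    then have "finite ((\<Union>\<psi> \<in> S \<union> T. vars \<psi>) - U)"
      by (metis finite.emptyI)
    ultimately show ?thesis
      using assms(4) by (simp only: P_def extension_stage_def split_conv)
  qed
  \<comment> \<open>Formulas are countable, so \<open>from_nat\<close> reaches each of them.\<close>
  define \<chi> :: "nat \<Rightarrow> ('p, 'v) fm" where "\<chi> = from_nat"
  have step: "\<exists>q. P q \<and> le p q \<and> (\<chi> n \<in> formulas_over U' \<longrightarrow> decides U' (\<chi> n) q)"
    if "P p" for p n
  proof (cases "\<chi> n \<in> formulas_over U'")
    case True
    from that have "extension_stage U U' (fst p, snd p)" by (simp add: P_def)
    from extension_stage_decide[OF inf this True] obtain S' T'
      where "extension_stage U U' (S', T')" "fst p \<subseteq> S'" "snd p \<subseteq> T'"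
        "decides U' (\<chi> n) (S', T')"
      by blast
    then show ?thesis
      by (intro exI[of _ "(S', T')"]) (simp add: P_def le_def)
  next
    case False
    with that show ?thesis
      by (intro exI[of _ p]) (simp add: le_def)
  qed
  \<comment> \<open>Dependent choice yields the chain of stages. The clause for \<open>n = 0\<close>
    fixes its start, and \<open>\<chi> n\<close> is decided at stage \<open>Suc n\<close>.\<close>
  have "\<exists>p. \<forall>n. (P (p n) \<and> (n = 0 \<longrightarrow> p n = (S, T))) \<and> le (p n) (p (Suc n)) \<and>
      (\<chi> n \<in> formulas_over U' \<longrightarrow> decides U' (\<chi> n) (p (Suc n)))"
    by (rule dependent_nat_choice) (use start step in auto)
  then obtain p where p: "P (p n)" "p 0 = (S, T)" "le (p n) (p (Suc n))"
      "\<chi> n \<in> formulas_over U' \<Longrightarrow> decides U' (\<chi> n) (p (Suc n))" for n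
    by blast

  define A where "A n = fst (p n)" for n
  define B where "B n = snd (p n)" for n
  have stage: "extension_stage U U' (A n, B n)" for n
    using p(1) by (simp add: P_def A_def B_def)
  have mono: "mono A" "mono B"
    using p(3) by (simp_all add: mono_iff_le_Suc A_def B_def le_def)
  have dec: "decides U' \<phi> (A (Suc (to_nat \<phi>)), B (Suc (to_nat \<phi>)))"
    if "\<phi> \<in> formulas_over U'" for \<phi>
    using p(4)[of "to_nat \<phi>"] that by (simp add: A_def B_def \<chi>_def)

  define S' where "S' = (\<Union>n. A n)"
  define T' where "T' = (\<Union>n. B n)"
  have sub: "A n \<subseteq> S'" "B n \<subseteq> T'" for n
    by (auto simp: S'_def T'_def)
  have over: "S' \<subseteq> formulas_over U'" "T' \<subseteq> formulas_over U'"
    using stage by (auto simp: S'_def T'_def extension_stage_def)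
  have cons: "finitely_consistent S' T'"
    unfolding finitely_consistent_def
  proof (intro allI impI notI, elim conjE)
    fix \<Gamma> \<Delta> assume "finite \<Gamma>" "\<Gamma> \<subseteq> S'" "finite \<Delta>" "\<Delta> \<subseteq> T'" and d: "\<Gamma> \<turnstile> \<Delta>"
    then obtain m n where "\<Gamma> \<subseteq> A m" "\<Delta> \<subseteq> B n"
      using finite_subset_incseq mono unfolding S'_def T'_def by meson
    \<comment> \<open>Both sides of the derivable sequent fit into one common stage, which is
      finitely consistent.\<close>
    then have "\<Gamma> \<subseteq> A (max m n)" "\<Delta> \<subseteq> B (max m n)"
      using mono[THEN monoD, of _ "max m n"] by (meson max.cobounded1 max.cobounded2 order_trans)+
    moreover have "finitely_consistent (A (max m n)) (B (max m n))"
      using stage by (auto simp: extension_stage_def)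
    ultimately show False
      using d finitely_consistentD by blast
  qed
  have "saturated U' S' T'"
  proof (rule saturated_if_maximal[OF over cons])
    fix \<phi> assume \<phi>: "\<phi> \<in> formulas_over U'" and c: "finitely_consistent (insert \<phi> S') T'"
    \<comment> \<open>Consistency with the limit passes down to every stage, in particular to the
      one at which \<open>\<phi>\<close> is decided.\<close>
    have "finitely_consistent (insert \<phi> (A n)) (B n)" for n
      using c by (rule finitely_consistent_mono) (use sub in auto)
    with dec[OF \<phi>] sub show "\<phi> \<in> S'"
      by (auto simp: decides_def)
  next
    fix \<phi> assume \<phi>: "\<phi> \<in> formulas_over U'" and c: "finitely_consistent S' (insert \<phi> T')"
    have "finitely_consistent (A n) (insert \<phi> (B n))" for n
      using c by (rule finitely_consistent_mono) (use sub in auto)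
    with dec[OF \<phi>] sub show "\<phi> \<in> T'"
      by (auto simp: decides_def)
  next
    fix x \<phi> assume all: "All x \<phi> \<in> T'"
    \<comment> \<open>The formula may have entered \<open>T'\<close> other than by its own decision,
      say as a witness instance. Being in \<open>T'\<close>, it is consistent with every stage, so
      its own decision supplies a witness.\<close>
    then have "finitely_consistent (A n) (insert (All x \<phi>) (B n))" for n
      using sub by (intro finitely_consistent_mono[OF cons]) auto
    with dec[of "All x \<phi>"] over all sub show "\<exists>z \<in> U'. subst \<phi> z x \<in> T'"
      by (auto simp: decides_def) blast
  qed
  moreover have "U \<subseteq> U'" "S \<subseteq> S'" "T \<subseteq> T'"
    using sub[of 0] p(2) by (auto simp: U'_def A_def B_def)
  ultimately show ?thesis
    using coinf by blast
qed

end
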